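(* Let $A$ be a nonempty finite set, let $d\in\mathbb{N}$, and let $\mathbf{S}:=(\mathbf{FN}_d A)^1$ be the free $d$-nilpotent semigroup on $A$ with adjoined identity. Then $\mathbf{S}$ is finitely related with degree at most $|S|+1$.
   Context: $\mathbb{N}=\{1,2,\dots\}$. For a nonempty set $A$, $\mathbf{A}^+$ is the free semigroup on $A$ (nonempty words over $A$ under concatenation). For an ideal $\mathbf{I}$ of a semigroup $\mathbf{S}$ (a subsemigroup with $si,is\in I$ for all $i\in I$, $s\in S$), the Rees quotient of $\mathbf{S}$ by $\mathbf{I}$ is $\mathbf{S}/\theta$ with $\theta=(I\times I)\cup\{(s,s)\mid s\in S\}$. The free $d$-nilpotent semigroup $\mathbf{FN}_d A$ is the Rees quotient of $\mathbf{A}^+$ by the ideal of all words of length at least $d$. For a semigroup $\mathbf{N}$, $\mathbf{N}^1$ denotes $\mathbf{N}$ with an adjoined identity element $1$. A semigroup term $t(x_1,\dots,x_n)$ is a (nonempty) word in the alphabet $x_1,\dots,x_n$; monoids are considered here as semigroups, i.e. with multiplication as the only operation. The $n$-ary term functions of $\mathbf{S}$ are the functions $t^{\mathbf{S}}:S^n\to S$ induced by terms $t(x_1,\dots,x_n)$ by evaluation. A function $f:S^n\to S$ preserves a relation $R\subseteq S^k$ if $f(r_1,\dots,r_n)\in R$ (with $f$ applied componentwise) whenever $r_1,\dots,r_n\in R$. $\mathbf{S}$ is finitely related if there are finitely many finitary relations $R_1,\dots,R_m$ on $S$ such that the finitary term functions of $\mathbf{S}$ are precisely the finitary functions on $S$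 that preserve $R_1,\dots,R_m$. For $f:S^n\to S$ and $1\le i<j\le n$ let $f_{ij}:S^n\to S$, $f_{ij}(x_1,\dots,x_n)=f(x_1,\dots,x_{i-1},x_j,x_{i+1},\dots,x_n)$. The degree of a finite algebra $\mathbf{S}$ is the least $k\in\mathbb{N}$ such that for all $n>k$ every $f:S^n\to S$ all of whose $f_{ij}$ ($1\le i<j\le n$) are term functions of $\mathbf{S}$ is itself a term function of $\mathbf{S}$. (It is a known fact that a finite algebra is finitely related if and only if such a $k$ exists.) *)

theory Defs
  imports "HOL-Library.FuncSet" "HOL-Algebra.Congruence"
begin

section \<open>Semigroups with an explicit carrier\<close>

text \<open>HOL-Algebra has monoids, whose identity is part of the signature, but no semigroups.\<close>

record 'a sgrp = "'a partial_object" +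
  sg_mult :: "'a \<Rightarrow> 'a \<Rightarrow> 'a"

definition is_semigroup :: "('a, 'm) sgrp_scheme \<Rightarrow> bool" where
  "is_semigroup S \<longleftrightarrow>
     (\<forall>x\<in>carrier S. \<forall>y\<in>carrier S. sg_mult S x y \<in> carrier S) \<and>
     (\<forall>x\<in>carrier S. \<forall>y\<in>carrier S. \<forall>z\<in>carrier S.
        sg_mult S (sg_mult S x y) z = sg_mult S x (sg_mult S y z))"

definition free_semigroup :: "'a set \<Rightarrow> 'a list sgrp" where
  "free_semigroup A = \<lparr>carrier = {w \<in> lists A. w \<noteq> []}, sg_mult = (@)\<rparr>"

definition is_semigroup_ideal :: "('a, 'm) sgrp_scheme \<Rightarrow> 'a set \<Rightarrow> bool" where
  "is_semigroup_ideal S I \<longleftrightarrow> I \<noteq> {} \<and> I \<subseteq> carrier S \<and>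
     (\<forall>i\<in>I. \<forall>s\<in>carrier S. sg_mult S s i \<in> I \<and> sg_mult S i s \<in> I)"

definition rees_congruence :: "('a, 'm) sgrp_scheme \<Rightarrow> 'a set \<Rightarrow> ('a \<times> 'a) set" where
  "rees_congruence S I = (I \<times> I) \<union> Id_on (carrier S)"

text \<open>The union in the product ranges over representatives; it is a single congruence
  class when the relation is a congruence (see \<open>sg_mult_rees_quotient\<close> below).\<close>

definition rees_quotient :: "('a, 'm) sgrp_scheme \<Rightarrow> 'a set \<Rightarrow> 'a set sgrp" where
  "rees_quotient S I =
     \<lparr>carrier = carrier S // rees_congruence S I,
      sg_mult = (\<lambda>X Y. \<Union>x\<in>X. \<Union>y\<in>Y. rees_congruence S I `` {sg_mult S x y})\<rparr>"

definition long_words :: "nat \<Rightarrow> 'a set \<Rightarrow> 'a list set" where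
  "long_words d A = {w \<in> carrier (free_semigroup A). d \<le> length w}"

definition free_nilpotent :: "nat \<Rightarrow> 'a set \<Rightarrow> 'a list set sgrp" where
  "free_nilpotent d A = rees_quotient (free_semigroup A) (long_words d A)"

text \<open>The identity \<open>None\<close> is always new, even if \<open>S\<close> already has an identity.\<close>

fun mult_one :: "('a \<Rightarrow> 'a \<Rightarrow> 'a) \<Rightarrow> 'a option \<Rightarrow> 'a option \<Rightarrow> 'a option" where
  "mult_one m None y = y"
| "mult_one m (Some x) None = Some x"
| "mult_one m (Some x) (Some y) = Some (m x y)"

definition adjoin_one :: "('a, 'm) sgrp_scheme \<Rightarrow> 'a option sgrp" where
  "adjoin_one S = \<lparr>carrier = insert None (Some ` carrier S), sg_mult = mult_one (sg_mult S)\<rparr>"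

section \<open>Operations and relations on a set\<close>

text \<open>An element \<open>(x\<^sub>1, \<dots>, x\<^sub>n)\<close> of \<open>C\<^sup>n\<close> is a list of length \<open>n\<close>,
  indexed from \<open>0\<close>. Operations are extensional, so that equality of operations is equality
  of functions on \<open>C\<^sup>n\<close>.\<close>

definition tuples :: "'a set \<Rightarrow> nat \<Rightarrow> 'a list set" where
  "tuples C n = {xs \<in> lists C. length xs = n}"

definition operations :: "'a set \<Rightarrow> nat \<Rightarrow> ('a list \<Rightarrow> 'a) set" where
  "operations C n = tuples C n \<rightarrow>\<^sub>E C"

text \<open>Relations carry their arity. In the definition, \<open>rs\<close> lists \<open>n\<close> tuples from \<open>R\<close>.\<close>

definition preserves :: "nat \<Rightarrow> ('a list \<Rightarrow> 'a) \<Rightarrow> nat \<times> 'a list set \<Rightarrow> bool" where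
  "preserves n f = (\<lambda>(k, R). \<forall>rs \<in> tuples R n. map (\<lambda>i. f (map (\<lambda>r. r ! i) rs)) [0..<k] \<in> R)"

definition identify_args ::
    "'a set \<Rightarrow> nat \<Rightarrow> nat \<Rightarrow> nat \<Rightarrow> ('a list \<Rightarrow> 'a) \<Rightarrow> 'a list \<Rightarrow> 'a" where
  "identify_args C n i j f = (\<lambda>xs \<in> tuples C n. f (xs[i := xs ! j]))"

section \<open>Term functions, finite relatedness, degree\<close>

text \<open>A term in \<open>n\<close> variables is a nonempty word over the alphabet \<open>{..<n}\<close>.\<close>

definition sg_terms :: "nat \<Rightarrow> nat list set" where
  "sg_terms n = carrier (free_semigroup {..<n})"

fun eval_term :: "('a, 'm) sgrp_scheme \<Rightarrow> nat list \<Rightarrow> 'a list \<Rightarrow> 'a" where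
  "eval_term S [] xs = undefined"
| "eval_term S [v] xs = xs ! v"
| "eval_term S (v # w # t) xs = sg_mult S (xs ! v) (eval_term S (w # t) xs)"

definition term_functions :: "('a, 'm) sgrp_scheme \<Rightarrow> nat \<Rightarrow> ('a list \<Rightarrow> 'a) set" where
  "term_functions S n = (\<lambda>t. \<lambda>xs \<in> tuples (carrier S) n. eval_term S t xs) ` sg_terms n"

definition finitely_related :: "('a, 'm) sgrp_scheme \<Rightarrow> bool" where
  "finitely_related S \<longleftrightarrow>
     (\<exists>Rels. finite Rels \<and> (\<forall>(k, R) \<in> Rels. 1 \<le> k \<and> R \<subseteq> tuples (carrier S) k) \<and>
        (\<forall>n\<ge>1. term_functions S n =
           {f \<in> operations (carrier S) n. \<forall>\<rho> \<in> Rels. preserves n f \<rho>}))"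

definition degree_bound :: "('a, 'm) sgrp_scheme \<Rightarrow> nat \<Rightarrow> bool" where
  "degree_bound S k \<longleftrightarrow>
     (\<forall>n>k. \<forall>f \<in> operations (carrier S) n.
        (\<forall>i j. i < j \<and> j < n \<longrightarrow> identify_args (carrier S) n i j f \<in> term_functions S n) \<longrightarrow>
        f \<in> term_functions S n)"

text \<open>The degree is a relation, not a function, because it need not exist.\<close>

definition has_degree :: "('a, 'm) sgrp_scheme \<Rightarrow> nat \<Rightarrow> bool" where
  "has_degree S k \<longleftrightarrow> 1 \<le> k \<and> degree_bound S k \<and> (\<forall>k'. 1 \<le> k' \<and> degree_bound S k' \<longrightarrow> k \<le> k')"

section \<open>The constructions are well defined\<close>

lemma is_semigroup_free_semigroup: "is_semigroup (free_semigroup A)"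
  by (auto simp: is_semigroup_def free_semigroup_def)

lemma long_words_ideal:
  assumes "A \<noteq> {}"
  shows "is_semigroup_ideal (free_semigroup A) (long_words d A)"
proof -
  from assms obtain a where "a \<in> A" by blast
  then have "replicate (Suc d) a \<in> long_words d A"
    by (auto simp: long_words_def free_semigroup_def)
  then have "long_words d A \<noteq> {}"
    by blast
  moreover have "long_words d A \<subseteq> carrier (free_semigroup A)"
    by (auto simp: long_words_def)
  moreover have "\<forall>i\<in>long_words d A. \<forall>s\<in>carrier (free_semigroup A).
      sg_mult (free_semigroup A) s i \<in> long_words d A \<and>
      sg_mult (free_semigroup A) i s \<in> long_words d A"
    by (auto simp: long_words_def free_semigroup_def)
  ultimately show ?thesis
    unfolding is_semigroup_ideal_def by blast
qed

lemma equiv_rees_congruence: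
  assumes "is_semigroup_ideal S I"
  shows "equiv (carrier S) (rees_congruence S I)"
  using assms
  by (auto simp: is_semigroup_ideal_def rees_congruence_def
      intro!: equivI refl_onI symI transI)

lemma sg_mult_rees_quotient:
  assumes S: "is_semigroup S" and I: "is_semigroup_ideal S I"
    and x: "x \<in> carrier S" and y: "y \<in> carrier S"
  shows "sg_mult (rees_quotient S I) (rees_congruence S I `` {x}) (rees_congruence S I `` {y}) =
    rees_congruence S I `` {sg_mult S x y}"
proof -
  let ?r = "rees_congruence S I"
  note eq = equiv_rees_congruence[OF I]
  have cong: "?r `` {sg_mult S x' y'} = ?r `` {sg_mult S x y}"
    if "(x, x') \<in> ?r" "(y, y') \<in> ?r" for x' y'
  proof -
    have closed: "sg_mult S x y \<in> carrier S"
      using S x y by (simp add: is_semigroup_def)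
    have cases: "x' = x \<or> x \<in> I \<and> x' \<in> I" "y' = y \<or> y \<in> I \<and> y' \<in> I"
      using that by (auto simp: rees_congruence_def)
    have carr: "x' \<in> carrier S" "y' \<in> carrier S"
      using cases I x y by (auto simp: is_semigroup_ideal_def)
    have abs: "sg_mult S s i \<in> I" "sg_mult S i s \<in> I" if "i \<in> I" "s \<in> carrier S" for s i
      using I that by (simp_all add: is_semigroup_ideal_def)
    have "(sg_mult S x y, sg_mult S x' y') \<in> ?r"
      using cases closed x y carr abs unfolding rees_congruence_def by (elim disjE) auto
    then show ?thesis
      using equiv_class_eq[OF eq] by metis
  qed
  have "x \<in> ?r `` {x}" "y \<in> ?r `` {y}"
    using x y by (auto simp: rees_congruence_def)
  then show ?thesis
    unfolding rees_quotient_def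
    by (simp only: sgrp.simps) (intro equalityI UN_least; use cong in blast)
qed

end

theory Submission
  imports Defs "HOL-Library.Multiset"
begin

text \<open>Every element of \<open>S\<close> is represented by a word over \<open>A\<close>, the identity by the empty word, and
  two words represent the same element iff they are equal or both have length at least \<open>d\<close>. To
  evaluate a term is to substitute words for its variables, so its term function sees two things
  only: how often each variable occurs, up to the cap \<open>d\<close>, and, if \<open>A\<close> has at least two letters,
  in what order the occurrences of two variables are interleaved, provided the two occur fewer
  than \<open>d\<close> times altogether. Conversely, these data determine the function
  (\<open>evaluations_eq\<close>), because a word is determined by its restrictions to pairs of letters.

  Let \<open>f\<close> have arity \<open>n \<ge> |S| + 2 \<ge> d + 3\<close>, and let all its identification minors be term
  functions. Where all but a few arguments are the identity, two identity arguments can be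
  identified, so \<open>f\<close> agrees there with a term. Hence occurrence numbers and interleavings of pairs
  are defined for \<open>f\<close>, and any three variables come with a common word. The heart of the
  proof is to merge these local words into one. Two variables are constrained iff the sum of
  their occurrence numbers is below \<open>d\<close>, so the constraint graph is a threshold graph: what
  is joined to some vertex is also joined to all lighter ones. Thus a cyclic sequence of
  constraints can be shortened at a vertex of minimal weight until it involves only three
  variables, where it contradicts their common word. So some letter can always come
  first (\<open>threshold_minimal\<close>), and the merged word is built letter by letter
  (\<open>threshold_merge\<close>).

  The merged term agrees with \<open>f\<close> on tuples with two identity entries. As \<open>n > |S| + 1\<close>, \<open>f\<close> does
  not depend on a variable of occurrence number zero. On the remaining tuples at most one
  variable contributes no letter, and as two entries are equal, the product is one of at least
  \<open>n - 3 \<ge> d\<close> letters for \<open>f\<close> as well as for the merged term (\<open>term_exists\<close>).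

  A degree bound \<open>k\<close> gives finite relatedness by way of a single relation, the graph of all
  \<open>k\<close>-ary term functions. An operation preserves it iff substituting \<open>k\<close>-ary term functions always
  gives term functions, and this passes to identification minors, so that induction on the arity
  applies (\<open>term_function_if_degree_bound\<close>).\<close>

section \<open>Words and their restrictions to few letters\<close>

text \<open>The restriction to the two first letters of the words shows that these are equal. Then they can
  be removed from both words.\<close>

lemma word_eq_if_pair_filters_eq:
  assumes "set u \<subseteq> X" "set w \<subseteq> X"
    and "\<And>k l. k \<in> X \<Longrightarrow> l \<in> X \<Longrightarrow>
      filter (\<lambda>v. v \<in> {k, l}) u = filter (\<lambda>v. v \<in> {k, l}) w"
  shows "u = w"
  using assms
proof (induction u arbitrary: w)
  case Nil
  show ?case
  proof (cases w)
    case (Cons b w')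
    then show ?thesis
      using Nil.prems(2) Nil.prems(3)[of b b] by simp
  qed simp
next
  case (Cons a u)
  have a: "a \<in> X"
    using Cons.prems(1) by simp
  obtain b w' where w: "w = b # w'"
    using Cons.prems(3)[OF a a] by (cases w) auto
  have b: "b \<in> X"
    using Cons.prems(2) w by simp
  have ab: "a = b"
    using Cons.prems(3)[OF a b] w by simp
  have "u = w'"
  proof (rule Cons.IH)
    show "filter (\<lambda>v. v \<in> {k, l}) u = filter (\<lambda>v. v \<in> {k, l}) w'"
      if "k \<in> X" "l \<in> X" for k l
      using Cons.prems(3)[OF that] w ab by (simp split: if_splits)
  qed (use Cons.prems w in auto)
  then show ?case
    using ab w by simp
qed

lemma filter_singleton_eq_replicate:
  "filter (\<lambda>v. v = k) u = replicate (count_list u k) k"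
  by (induction u) auto

lemma length_filter_pair:
  "k \<noteq> l \<Longrightarrow> length (filter (\<lambda>v. v \<in> {k, l}) u) = count_list u k + count_list u l"
  by (induction u) auto

text \<open>The relation \<open>L\<close> is transitive only along triples whose members are pairwise light enough, yet it
  cannot have cycles. Let \<open>v\<close> have minimal weight. If some elements precede \<open>v\<close>, a minimal one
  \<open>y\<close> among them is minimal in \<open>F\<close>: an element that precedes \<open>y\<close> is light enough together with
  \<open>y\<close>, hence together with \<open>v\<close>, and by transitivity it would precede \<open>v\<close> as well.\<close>

lemma threshold_minimal:
  fixes c :: "'v \<Rightarrow> nat"
  assumes "finite F" "F \<noteq> {}"
    and thr: "\<And>k l. L k l \<Longrightarrow> c k + c l < D"
    and asym: "\<And>k l. L k l \<Longrightarrow> \<not> L l k"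
    and trans: "\<And>k l m. k \<in> F \<Longrightarrow> l \<in> F \<Longrightarrow> m \<in> F \<Longrightarrow> L k l \<Longrightarrow> L l m \<Longrightarrow>
      c k + c m < D \<Longrightarrow> L k m"
  shows "\<exists>a\<in>F. \<forall>z\<in>F. \<not> L z a"
  using assms(1,2) trans
proof (induction F rule: finite_psubset_induct)
  case (psubset F)
  obtain v where v: "v \<in> F" "\<And>u. u \<in> F \<Longrightarrow> c v \<le> c u"
    using ex_min_if_finite[of "c ` F"] psubset.hyps psubset.prems(1)
    by (metis (no_types, lifting) arg_min_if_finite(1) arg_min_least)
  define F' where "F' = {y \<in> F. L y v}"
  show ?case
  proof (cases "F' = {}")
    case True
    then show ?thesis
      using v by (auto simp: F'_def)
  next
    case False
    have "F' \<subset> F"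
      using v asym by (auto simp: F'_def)
    then obtain y where y: "y \<in> F'" "\<And>z. z \<in> F' \<Longrightarrow> \<not> L z y"
      using psubset.IH[of F'] False psubset.prems(2) by (metis (no_types, lifting) psubsetD)
    have "\<not> L z y" if z: "z \<in> F" for z
    proof
      assume zy: "L z y"
      have "y \<in> F" "L y v"
        using y(1) by (auto simp: F'_def)
      moreover have "c z + c v < D"
        using thr[OF zy] v(2)[OF \<open>y \<in> F\<close>] by simp
      ultimately have "L z v"
        using psubset.prems(2)[of z y v] z zy v(1) by blast
      then show False
        using y(2)[of z] zy z by (auto simp: F'_def)
    qed
    then show ?thesis
      using y(1) by (auto simp: F'_def)
  qed
qed

text \<open>Cardinality three is what transitivity needs.\<close>

definition threshold_clique :: "'v set \<Rightarrow> ('v \<Rightarrow> nat) \<Rightarrow> nat \<Rightarrow> 'v set \<Rightarrow> bool" where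
  "threshold_clique V c D X \<longleftrightarrow> X \<subseteq> V \<and> finite X \<and> card X \<le> 3 \<and>
     (\<forall>k\<in>X. \<forall>l\<in>X. k \<noteq> l \<longrightarrow> c k + c l < D)"

lemma threshold_clique_subset:
  "threshold_clique V c D X \<Longrightarrow> Y \<subseteq> X \<Longrightarrow> threshold_clique V c D Y"
  unfolding threshold_clique_def
  by (meson card_mono finite_subset le_trans subset_eq)

lemma threshold_clique_singleton: "k \<in> V \<Longrightarrow> threshold_clique V c D {k}"
  by (simp add: threshold_clique_def)

lemma threshold_clique_pair:
  "k \<in> V \<Longrightarrow> l \<in> V \<Longrightarrow> c k + c l < D \<Longrightarrow> threshold_clique V c D {k, l}"
  by (auto simp: threshold_clique_def add.commute card_insert_if)

lemma hd_filter: "u \<noteq> [] \<Longrightarrow> P (hd u) \<Longrightarrow> filter P u \<noteq> [] \<and> hd (filter P u) = hd u"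
  by (cases u) auto

text \<open>A family of words on small cliques that is closed under restriction consists of the
  restrictions of one word. The word is built from the left. By \<open>threshold_minimal\<close>, applied to the
  relation that \<open>k\<close> comes first in the word on \<open>{k, l}\<close>, there is a letter \<open>a\<close> that comes first
  in every word \<open>g X\<close> with \<open>a \<in> X\<close>. It is removed from these words.\<close>

lemma threshold_merge:
  fixes g :: "'v set \<Rightarrow> 'v list" and c :: "'v \<Rightarrow> nat"
  assumes "finite V"
    and letters: "\<And>X. threshold_clique V c D X \<Longrightarrow> set (g X) \<subseteq> X"
    and restrict: "\<And>X Y. threshold_clique V c D X \<Longrightarrow> Y \<subseteq> X \<Longrightarrow>
      filter (\<lambda>v. v \<in> Y) (g X) = g Y"
  shows "\<exists>t. set t \<subseteq> V \<and> (\<forall>X. threshold_clique V c D X \<longrightarrow> filter (\<lambda>v. v \<in> X) t = g X)"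
  using letters restrict
proof (induction "\<Sum>k\<in>V. length (g {k})" arbitrary: g rule: less_induct)
  case less
  note letters = less.prems(1) and restrict = less.prems(2)
  let ?K = "threshold_clique V c D"
  define F where "F = {k \<in> V. g {k} \<noteq> []}"
  show ?case
  proof (cases "F = {}")
    case True
    have "g X = []" if X: "?K X" for X
    proof (rule ccontr)
      assume "g X \<noteq> []"
      then obtain k where k: "k \<in> set (g X)"
        by (meson last_in_set)
      then have "k \<in> X"
        using letters[OF X] by blast
      then have "k \<in> V" "g {k} \<noteq> []"
        using restrict[OF X, of "{k}"] X k by (auto simp: threshold_clique_def filter_empty_conv)
      then show False
        using True by (auto simp: F_def)
    qed
    then show ?thesis
      by (intro exI[of _ "[]"]) auto
  next
    case False
    define L where "L k l \<longleftrightarrow> k \<in> F \<and> l \<in> F \<and> k \<noteq> l \<and> c k + c l < D \<and> hd (g {k, l}) = k" for k l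
    have hd_clique: "hd (g Y) = hd (g X)" if "?K X" "Y \<subseteq> X" "g X \<noteq> []" "hd (g X) \<in> Y" for X Y
      using hd_filter[of "g X" "\<lambda>v. v \<in> Y"] that restrict[of X Y] by simp
    have nonempty: "g X \<noteq> []" if "?K X" "k \<in> X" "k \<in> F" for X k
      using restrict[OF that(1), of "{k}"] that by (auto simp: F_def)
    have "\<exists>a\<in>F. \<forall>z\<in>F. \<not> L z a"
    proof (rule threshold_minimal)
      show "finite F"
        using \<open>finite V\<close> by (simp add: F_def)
      show "F \<noteq> {}" by fact
      show "c k + c l < D" if "L k l" for k l
        using that by (simp add: L_def)
      show "\<not> L l k" if "L k l" for k l
        using that by (auto simp: L_def insert_commute)
    next
      fix k l m
      assume klm: "k \<in> F" "l \<in> F" "m \<in> F" "L k l" "L l m" "c k + c m < D"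
      let ?X = "{k, l, m}"
      have "k \<noteq> m"
        using klm(4,5) by (auto simp: L_def insert_commute)
      have X: "?K ?X"
        using klm by (auto simp: threshold_clique_def L_def F_def add.commute card_insert_if)
      \<comment> \<open>The common word starts with one of the three letters, and the pair words exclude \<open>l\<close> and \<open>m\<close>.\<close>
      have ne: "g ?X \<noteq> []"
        using nonempty[OF X] klm by blast
      then have "hd (g ?X) \<in> ?X"
        using letters[OF X] by (meson hd_in_set subsetD)
      moreover have "hd (g ?X) \<noteq> l"
        using hd_clique[OF X, of "{k, l}"] ne klm(4) by (auto simp: L_def)
      moreover have "hd (g ?X) \<noteq> m"
        using hd_clique[OF X, of "{l, m}"] ne klm(5) by (auto simp: L_def)
      ultimately have "hd (g ?X) = k"
        by blast
      then have "hd (g {k, m}) = k"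
        using hd_clique[OF X, of "{k, m}"] ne by auto
      then show "L k m"
        using klm \<open>k \<noteq> m\<close> by (simp add: L_def)
    qed
    then obtain a where a: "a \<in> F" and a_min: "\<And>z. z \<in> F \<Longrightarrow> \<not> L z a"
      by blast
    have aV: "a \<in> V"
      using a by (simp add: F_def)
    have a_first: "g X = a # tl (g X)" if X: "?K X" "a \<in> X" for X
    proof -
      let ?h = "hd (g X)"
      have ne: "g X \<noteq> []"
        using nonempty X a by blast
      then have hX: "?h \<in> X"
        using letters[OF X(1)] by (meson hd_in_set subsetD)
      have "?h = a"
      proof (rule ccontr)
        assume neq: "?h \<noteq> a"
        have "hd (g {?h, a}) = ?h"
          using hd_clique[OF X(1), of "{?h, a}"] ne hX X by simp
        moreover have "?h \<in> F"
        proof -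
          have "g {?h} \<noteq> []"
            using restrict[OF X(1), of "{?h}"] hX ne hd_filter[of "g X" "\<lambda>v. v \<in> {?h}"] by auto
          then show ?thesis
            using X(1) hX by (auto simp: F_def threshold_clique_def)
        qed
        moreover have "c ?h + c a < D"
          using X hX neq by (simp add: threshold_clique_def)
        ultimately show False
          using a_min[of ?h] a neq by (simp add: L_def)
      qed
      then show ?thesis
        using ne by (metis list.collapse)
    qed
    define g' where "g' X = (if a \<in> X then tl (g X) else g X)" for X
    have "\<exists>t. set t \<subseteq> V \<and> (\<forall>X. ?K X \<longrightarrow> filter (\<lambda>v. v \<in> X) t = g' X)"
    proof (rule less.hyps)
      have ga: "length (g' {a}) < length (g {a})"
        using a by (simp add: g'_def F_def)
      show "(\<Sum>k\<in>V. length (g' {k})) < (\<Sum>k\<in>V. length (g {k}))"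
        by (rule sum_strict_mono_ex1) (use \<open>finite V\<close> aV ga in \<open>auto simp: g'_def\<close>)
    next
      show "set (g' X) \<subseteq> X" if "?K X" for X
        using letters[OF that] by (cases "g X") (auto simp: g'_def)
    next
      show "filter (\<lambda>v. v \<in> Y) (g' X) = g' Y" if X: "?K X" and Y: "Y \<subseteq> X" for X Y
      proof (cases "a \<in> X")
        case True
        note split = a_first[OF X True]
        show ?thesis
        proof (cases "a \<in> Y")
          case aY: True
          then have "g Y = a # filter (\<lambda>v. v \<in> Y) (tl (g X))"
            using restrict[OF X Y] split by (metis filter.simps(2))
          then show ?thesis
            using True aY by (simp add: g'_def)
        next
          case aY: False
          then have "g Y = filter (\<lambda>v. v \<in> Y) (tl (g X))"
            using restrict[OF X Y] split by (metis filter.simps(2))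
          then show ?thesis
            using True aY by (simp add: g'_def)
        qed
      next
        case False
        then show ?thesis
          using restrict[OF X Y] Y by (auto simp: g'_def)
      qed
    qed
    then obtain t where t: "set t \<subseteq> V" "\<And>X. ?K X \<Longrightarrow> filter (\<lambda>v. v \<in> X) t = g' X"
      by blast
    show ?thesis
    proof (intro exI[of _ "a # t"] conjI allI impI)
      show "set (a # t) \<subseteq> V"
        using t(1) aV by simp
      show "filter (\<lambda>v. v \<in> X) (a # t) = g X" if "?K X" for X
        using t(2)[OF that] a_first[OF that] by (auto simp: g'_def)
    qed
  qed
qed

section \<open>What a term function determines about its term\<close>

text \<open>The words represent the same element of the free \<open>d\<close>-nilpotent semigroup with identity.\<close>

definition nil_eq :: "nat \<Rightarrow> 'a list \<Rightarrow> 'a list \<Rightarrow> bool" where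
  "nil_eq d u w \<longleftrightarrow> u = w \<or> d \<le> length u \<and> d \<le> length w"

text \<open>Term functions detect how two variables are interleaved iff the total number of their
  occurrences is below this bound. Over a single letter, where \<open>S\<close> is commutative, it is zero, so that both cases
  can be treated together.\<close>

definition order_threshold :: "nat \<Rightarrow> 'a set \<Rightarrow> nat" where
  "order_threshold d A = (if \<exists>a\<in>A. \<exists>b\<in>A. a \<noteq> b then d else 0)"

definition supported_assignment :: "'v set \<Rightarrow> 'a set \<Rightarrow> ('v \<Rightarrow> 'a list) \<Rightarrow> bool" where
  "supported_assignment P A \<sigma> \<longleftrightarrow> (\<forall>k. \<sigma> k \<in> lists A) \<and> (\<forall>k. k \<notin> P \<longrightarrow> \<sigma> k = [])"

lemma nil_eq_refl [simp]: "nil_eq d u u"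
  by (simp add: nil_eq_def)

lemma concat_map_replicate_letter:
  "concat (map (\<lambda>v. if v = k then w else []) s) = concat (replicate (count_list s k) w)"
  by (induction s) auto

text \<open>Put a letter for \<open>k\<close> and the identity for all other variables.\<close>

lemma counts_eq_if_evaluations_eq:
  assumes "a \<in> A" "k \<in> P"
    and "\<And>\<sigma>. supported_assignment P A \<sigma> \<Longrightarrow> nil_eq d (concat (map \<sigma> s)) (concat (map \<sigma> t))"
  shows "min d (count_list s k) = min d (count_list t k)"
proof -
  let ?\<sigma> = "\<lambda>v. if v = k then [a] else []"
  have "supported_assignment P A ?\<sigma>"
    using assms(1,2) by (auto simp: supported_assignment_def)
  from assms(3)[OF this] show ?thesis
    by (auto simp: concat_map_replicate_letter nil_eq_def length_concat sum_list_replicate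
        dest: arg_cong[where f = length])
qed

text \<open>Put different letters for \<open>k\<close> and \<open>l\<close> and the identity for all other variables.\<close>

lemma pair_filters_eq_if_evaluations_eq:
  assumes kl: "k \<in> P" "l \<in> P" "k \<noteq> l"
    and small: "count_list s k + count_list s l < order_threshold d A"
    and eq: "\<And>\<sigma>. supported_assignment P A \<sigma> \<Longrightarrow> nil_eq d (concat (map \<sigma> s)) (concat (map \<sigma> t))"
  shows "filter (\<lambda>v. v \<in> {k, l}) s = filter (\<lambda>v. v \<in> {k, l}) t"
proof -
  obtain a b where ab: "a \<in> A" "b \<in> A" "a \<noteq> b" and d: "count_list s k + count_list s l < d"
    using small by (auto simp: order_threshold_def split: if_splits)
  let ?\<sigma> = "\<lambda>v. if v = k then [a] else if v = l then [b] else []"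
  let ?c = "\<lambda>v. if v = k then a else b"
  have ev: "concat (map ?\<sigma> u) = map ?c (filter (\<lambda>v. v \<in> {k, l}) u)" for u
    by (induction u) auto
  have "supported_assignment P A ?\<sigma>"
    using kl ab by (auto simp: supported_assignment_def)
  from eq[OF this] have "map ?c (filter (\<lambda>v. v \<in> {k, l}) s) = map ?c (filter (\<lambda>v. v \<in> {k, l}) t)"
    using d length_filter_pair[OF kl(3), of s] unfolding ev nil_eq_def by auto
  then show ?thesis
  proof (rule map_inj_on)
    show "inj_on ?c (set (filter (\<lambda>v. v \<in> {k, l}) s) \<union> set (filter (\<lambda>v. v \<in> {k, l}) t))"
      using ab kl by (auto simp: inj_on_def)
  qed
qed

lemma filter_eq_if_pairs:
  assumes counts: "\<And>k. k \<in> Q \<Longrightarrow> count_list s k = count_list t k"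
    and pairs: "\<And>k l. k \<in> Q \<Longrightarrow> l \<in> Q \<Longrightarrow> k \<noteq> l \<Longrightarrow>
      filter (\<lambda>v. v \<in> {k, l}) s = filter (\<lambda>v. v \<in> {k, l}) t"
  shows "filter (\<lambda>v. v \<in> Q) s = filter (\<lambda>v. v \<in> Q) t"
proof (rule word_eq_if_pair_filters_eq[of _ Q])
  fix k l
  assume kl: "k \<in> Q" "l \<in> Q"
  have f: "filter (\<lambda>v. v \<in> {k, l}) (filter (\<lambda>v. v \<in> Q) u) = filter (\<lambda>v. v \<in> {k, l}) u" for u
    using kl by (induction u) auto
  show "filter (\<lambda>v. v \<in> {k, l}) (filter (\<lambda>v. v \<in> Q) s) =
      filter (\<lambda>v. v \<in> {k, l}) (filter (\<lambda>v. v \<in> Q) t)"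
  proof (cases "k = l")
    case True
    then show ?thesis
      unfolding f using counts[OF kl(1)] by (simp add: filter_singleton_eq_replicate)
  next
    case False
    then show ?thesis
      unfolding f using pairs kl by blast
  qed
qed auto

lemma count_le_length_concat:
  "\<sigma> k \<noteq> [] \<Longrightarrow> count_list s k \<le> length (concat (map \<sigma> s))"
proof (induction s)
  case (Cons x s)
  then show ?case
    by (cases "\<sigma> x") auto
qed simp

lemma length_filter_le_length_concat:
  "\<forall>v\<in>Q. \<sigma> v \<noteq> [] \<Longrightarrow> length (filter (\<lambda>v. v \<in> Q) s) \<le> length (concat (map \<sigma> s))"
proof (induction s)
  case (Cons x s)
  then show ?case
    by (cases "\<sigma> x") auto
qed simp

text \<open>Let \<open>Q\<close> be the set of variables to which \<open>\<sigma>\<close> assigns a nonempty word. If one of them occurs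
  \<open>d\<close> times, both values are long. Otherwise the occurrence numbers on \<open>Q\<close> are equal, hence so
  are the lengths of the values. If these are below \<open>d\<close>, any two variables in \<open>Q\<close> together occur
  fewer than \<open>d\<close> times, so the restrictions of \<open>s\<close> and \<open>t\<close> to \<open>Q\<close> are equal by the assumption on
  pairs. Over a single letter, words of equal length are equal.\<close>

lemma evaluations_eq:
  assumes \<sigma>: "supported_assignment P A \<sigma>"
    and counts: "\<And>k. k \<in> P \<Longrightarrow> min d (count_list s k) = min d (count_list t k)"
    and pairs: "\<And>k l. k \<in> P \<Longrightarrow> l \<in> P \<Longrightarrow> k \<noteq> l \<Longrightarrow>
      count_list s k + count_list s l < order_threshold d A \<Longrightarrow>
      filter (\<lambda>v. v \<in> {k, l}) s = filter (\<lambda>v. v \<in> {k, l}) t"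
  shows "nil_eq d (concat (map \<sigma> s)) (concat (map \<sigma> t))"
proof -
  let ?e = "\<lambda>s. concat (map \<sigma> s)"
  define Q where "Q = {k. \<sigma> k \<noteq> []}"
  have QP: "Q \<subseteq> P"
    using \<sigma> by (auto simp: supported_assignment_def Q_def)
  have eQ: "?e u = ?e (filter (\<lambda>v. v \<in> Q) u)" for u
    by (induction u) (auto simp: Q_def)
  have ne: "\<forall>v\<in>Q. \<sigma> v \<noteq> []"
    by (simp add: Q_def)
  show ?thesis
  proof (cases "\<exists>k\<in>Q. d \<le> count_list s k")
    case True
    then obtain k where k: "k \<in> Q" "d \<le> count_list s k"
      by blast
    then have "d \<le> count_list t k"
      using counts[of k] QP by (auto simp: min_def split: if_splits)
    then show ?thesis
      using k count_le_length_concat[of \<sigma> k s] count_le_length_concat[of \<sigma> k t]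
      by (simp add: nil_eq_def Q_def)
  next
    case False
    have cnt: "count_list s k = count_list t k" if "k \<in> Q" for k
    proof -
      have "k \<in> P" "count_list s k < d"
        using QP False that by auto
      then show ?thesis
        using counts[of k] by (auto simp: min_def split: if_splits)
    qed
    have "mset (filter (\<lambda>v. v \<in> Q) s) = mset (filter (\<lambda>v. v \<in> Q) t)"
      using cnt by (intro multiset_eqI) (simp add: count_mset)
    moreover have "length (?e u) = (\<Sum>v\<in>#mset u. length (\<sigma> v))" for u
      by (induction u) auto
    ultimately have "length (?e (filter (\<lambda>v. v \<in> Q) s)) = length (?e (filter (\<lambda>v. v \<in> Q) t))"
      by simp
    then have len: "length (?e s) = length (?e t)"
      by (simp only: eQ[symmetric])
    have "?e s = ?e t" if short: "length (?e s) < d"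
    proof (cases "\<exists>a\<in>A. \<exists>b\<in>A. a \<noteq> b")
      case True
      have "filter (\<lambda>v. v \<in> Q) s = filter (\<lambda>v. v \<in> Q) t"
      proof (rule filter_eq_if_pairs)
        fix k l
        assume kl: "k \<in> Q" "l \<in> Q" "k \<noteq> l"
        have "count_list s k + count_list s l = length (filter (\<lambda>v. v \<in> {k, l}) s)"
          using length_filter_pair[OF kl(3)] by metis
        also have "\<dots> \<le> length (?e s)"
          by (rule length_filter_le_length_concat) (use kl ne in auto)
        finally show "filter (\<lambda>v. v \<in> {k, l}) s = filter (\<lambda>v. v \<in> {k, l}) t"
          using pairs[of k l] kl QP short True by (auto simp: order_threshold_def)
      qed (use cnt in auto)
      then have "?e (filter (\<lambda>v. v \<in> Q) s) = ?e (filter (\<lambda>v. v \<in> Q) t)"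
        by simp
      then show ?thesis
        by (simp only: eQ[symmetric])
    next
      case False
      have "set (?e u) \<subseteq> A" for u
        using \<sigma> by (auto simp: supported_assignment_def)
      then have "(?e s) ! i \<in> A" "(?e t) ! i \<in> A" if "i < length (?e s)" for i
        using that len nth_mem[of i "?e s"] nth_mem[of i "?e t"] by auto
      then have "(?e s) ! i = (?e t) ! i" if "i < length (?e s)" for i
        using False that by blast
      then show ?thesis
        using len by (intro nth_equalityI) auto
    qed
    then show ?thesis
      using len by (auto simp: nil_eq_def)
  qed
qed

lemma card_le_length_concat:
  assumes "finite U" "\<And>k. k \<in> U \<Longrightarrow> k \<in> set s \<and> \<sigma> k \<noteq> []"
  shows "card U \<le> length (concat (map \<sigma> s))"
proof -
  have "U \<subseteq> set (filter (\<lambda>v. v \<in> U) s)"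
    using assms(2) by auto
  then have "card U \<le> card (set (filter (\<lambda>v. v \<in> U) s))"
    by (intro card_mono) auto
  also have "\<dots> \<le> length (filter (\<lambda>v. v \<in> U) s)"
    by (rule card_length)
  also have "\<dots> \<le> length (concat (map \<sigma> s))"
    by (rule length_filter_le_length_concat) (use assms(2) in blast)
  finally show ?thesis .
qed

lemma count_list_concat_replicate:
  "distinct xs \<Longrightarrow> count_list (concat (map (replicate d) xs)) k = (if k \<in> set xs then d else 0)"
proof (induction xs)
  case (Cons x xs)
  have "count_list (replicate m x) k = (if k = x then m else 0)" for m
    by (induction m) auto
  with Cons show ?case
    by auto
qed simp

lemma filter_pair_absent:
  "count_list u k = 0 \<Longrightarrow> filter (\<lambda>v. v \<in> {k, l}) u = replicate (count_list u l) l"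
  by (induction u) (auto split: if_splits)

section \<open>Reconstructing a term from its identification minors\<close>

text \<open>The situation of the degree bound, phrased with words. An assignment \<open>\<sigma>\<close> stands for the
  tuple of the values \<open>val (\<sigma> k)\<close> with \<open>k < n\<close>, and \<open>F \<sigma>\<close> for the value of an \<open>n\<close>-ary operation
  on it. That all identification minors are term functions means that on tuples with equal entries
  at \<open>i\<close> and \<open>j\<close> the operation is given by a term \<open>T i j\<close>.\<close>

locale identification_minors =
  fixes A :: "'a set" and d n :: nat and a :: 'a and val :: "'a list \<Rightarrow> 'b"
    and F :: "(nat \<Rightarrow> 'a list) \<Rightarrow> 'b" and T :: "nat \<Rightarrow> nat \<Rightarrow> nat list"
  assumes a: "a \<in> A" and d: "1 \<le> d"
    and val: "\<And>u w. u \<in> lists A \<Longrightarrow> w \<in> lists A \<Longrightarrow> val u = val w \<longleftrightarrow> nil_eq d u w"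
    and finite_values: "finite (val ` lists A)"
    and arity: "card (val ` lists A) + 2 \<le> n"
    and T: "\<And>i j. i < n \<Longrightarrow> j < n \<Longrightarrow> i \<noteq> j \<Longrightarrow> T i j \<noteq> [] \<and> set (T i j) \<subseteq> {..<n}"
    and F_identified: "\<And>i j \<sigma>. i < n \<Longrightarrow> j < n \<Longrightarrow> i \<noteq> j \<Longrightarrow> (\<And>k. \<sigma> k \<in> lists A) \<Longrightarrow>
      val (\<sigma> i) = val (\<sigma> j) \<Longrightarrow> F \<sigma> = val (concat (map \<sigma> (T i j)))"
begin

abbreviation evaluate :: "(nat \<Rightarrow> 'a list) \<Rightarrow> nat list \<Rightarrow> 'a list" where
  "evaluate \<sigma> s \<equiv> concat (map \<sigma> s)"

lemma evaluate_in_lists: "(\<And>k. \<sigma> k \<in> lists A) \<Longrightarrow> evaluate \<sigma> s \<in> lists A"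
  unfolding in_lists_conv_set by auto

lemma val_evaluate_eqI:
  "(\<And>k. \<sigma> k \<in> lists A) \<Longrightarrow> nil_eq d (evaluate \<sigma> s) (evaluate \<sigma> s') \<Longrightarrow>
    val (evaluate \<sigma> s) = val (evaluate \<sigma> s')"
  using val evaluate_in_lists by blast

text \<open>The powers of \<open>a\<close> with exponents \<open>0, \<dots>, d\<close> have different values. So the arity exceeds \<open>d\<close>
  by at least three, and a product to which all but three variables contribute is long.\<close>

lemma card_values_ge: "d + 1 \<le> card (val ` lists A)"
proof -
  have "inj_on (\<lambda>l. val (replicate l a)) {..d}"
  proof (rule inj_onI)
    fix l m
    assume "l \<in> {..d}" "m \<in> {..d}" "val (replicate l a) = val (replicate m a)"
    moreover have "replicate l a \<in> lists A" "replicate m a \<in> lists A"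
      using a by (auto simp: in_lists_conv_set)
    ultimately have "nil_eq d (replicate l a) (replicate m a)"
      using val by blast
    with \<open>l \<in> {..d}\<close> \<open>m \<in> {..d}\<close> show "l = m"
      by (auto simp: nil_eq_def)
  qed
  then have "card {..d} \<le> card (val ` lists A)"
    by (rule card_inj_on_le) (use a finite_values in auto)
  then show ?thesis
    by simp
qed

lemma repeated_value:
  assumes "card (val ` lists A) < card I" "\<And>k. \<sigma> k \<in> lists A"
  shows "\<exists>i\<in>I. \<exists>j\<in>I. i \<noteq> j \<and> val (\<sigma> i) = val (\<sigma> j)"
proof -
  have "card ((\<lambda>k. val (\<sigma> k)) ` I) \<le> card (val ` lists A)"
    by (rule card_mono) (use finite_values assms in auto)
  then have "\<not> inj_on (\<lambda>k. val (\<sigma> k)) I"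
    using assms(1) by (intro pigeonhole) simp
  then show ?thesis
    by (auto simp: inj_on_def)
qed

definition outside :: "nat set \<Rightarrow> nat \<Rightarrow> nat \<Rightarrow> bool" where
  "outside X i j \<longleftrightarrow> i < n \<and> j < n \<and> i \<noteq> j \<and> i \<notin> X \<and> j \<notin> X"

lemma outside_exists:
  assumes "finite X" "card X + 2 \<le> n"
  shows "\<exists>i j. outside X i j"
proof -
  have "card {..<n} - card X \<le> card ({..<n} - X)"
    using assms(1) by (rule diff_card_le_card_Diff)
  then have "\<not> card ({..<n} - X) \<le> Suc 0"
    using assms(2) by simp
  then show ?thesis
    by (subst (asm) card_le_Suc0_iff_eq) (auto simp: outside_def)
qed

text \<open>On assignments supported on \<open>X\<close>, two coordinates outside \<open>X\<close> both carry the identity, so all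
  the terms \<open>T i j\<close> with \<open>i\<close> and \<open>j\<close> outside \<open>X\<close> compute \<open>F\<close> there.\<close>

lemma minors_agree:
  assumes "outside X i j" "outside X i' j'" "supported_assignment X A \<sigma>"
  shows "nil_eq d (evaluate \<sigma> (T i j)) (evaluate \<sigma> (T i' j'))"
proof -
  have \<sigma>: "\<And>k. \<sigma> k \<in> lists A"
    using assms(3) by (simp add: supported_assignment_def)
  have "F \<sigma> = val (evaluate \<sigma> (T i j))" "F \<sigma> = val (evaluate \<sigma> (T i' j'))"
    using assms by (auto intro!: F_identified simp: outside_def supported_assignment_def)
  then show ?thesis
    using val evaluate_in_lists \<sigma> by metis
qed

text \<open>A choice of one of the terms that compute \<open>F\<close> on the assignments supported on \<open>X\<close>. The
  variables outside \<open>X\<close> may occur in it.\<close>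

definition minor_outside :: "nat set \<Rightarrow> nat list" where
  "minor_outside X = (SOME s. \<exists>i j. outside X i j \<and> s = T i j)"

lemma minor_outside:
  assumes "finite X" "card X + 2 \<le> n"
  shows "\<exists>i j. outside X i j \<and> minor_outside X = T i j"
  unfolding minor_outside_def by (rule someI_ex) (use outside_exists[OF assms] in blast)

text \<open>The number of occurrences of \<open>k\<close> in the term to be found, as far as \<open>F\<close> can tell.\<close>

definition occurrences :: "nat \<Rightarrow> nat" where
  "occurrences k = min d (count_list (minor_outside {k}) k)"

lemma occurrences_le: "occurrences k \<le> d"
  by (simp add: occurrences_def)

lemma count_minor:
  assumes "outside {k} i j"
  shows "min d (count_list (T i j) k) = occurrences k"
proof -
  obtain i' j' where ij': "outside {k} i' j'" "minor_outside {k} = T i' j'"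
    using minor_outside[of "{k}"] arity card_values_ge d by auto
  show ?thesis
    unfolding occurrences_def ij'(2)
    by (rule counts_eq_if_evaluations_eq[OF a, of k "{k}"])
      (use minors_agree assms ij'(1) in auto)
qed

lemma pair_filters_minors_eq:
  assumes "outside {k, l} i j" "outside {k, l} i' j'" "k \<noteq> l"
    and small: "occurrences k + occurrences l < order_threshold d A"
  shows "filter (\<lambda>v. v \<in> {k, l}) (T i j) = filter (\<lambda>v. v \<in> {k, l}) (T i' j')"
proof (rule pair_filters_eq_if_evaluations_eq[of k "{k, l}" l])
  have "min d (count_list (T i j) k) = occurrences k" "min d (count_list (T i j) l) = occurrences l"
    using assms by (auto intro!: count_minor simp: outside_def)
  then show "count_list (T i j) k + count_list (T i j) l < order_threshold d A"
    using small by (auto simp: order_threshold_def min_def split: if_splits)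
qed (use assms minors_agree in auto)

text \<open>The variables that pose a merging problem: the others are absent or occur so often that nothing
  about their position is known.\<close>

definition rare :: "nat set" where
  "rare = {k. k < n \<and> 0 < occurrences k \<and> occurrences k < d}"

abbreviation clique :: "nat set \<Rightarrow> bool" where
  "clique \<equiv> threshold_clique rare occurrences (order_threshold d A)"

text \<open>If there are rare variables at all, then \<open>d \<ge> 2\<close> and the arity is at least five. So three
  variables always leave two coordinates to be identified.\<close>

lemma minor_outside_clique:
  assumes "clique X"
  shows "\<exists>i j. outside X i j \<and> minor_outside X = T i j"
proof (rule minor_outside)
  show "finite X"
    using assms by (simp add: threshold_clique_def)
  show "card X + 2 \<le> n"
  proof (cases "X = {}")
    case True
    then show ?thesis
      using arity by simp
  next
    case False
    then have "2 \<le> d"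
      using assms by (auto simp: threshold_clique_def rare_def)
    then show ?thesis
      using assms arity card_values_ge by (auto simp: threshold_clique_def)
  qed
qed

lemma count_minor_clique:
  assumes "clique X" "k \<in> X"
  shows "count_list (minor_outside X) k = occurrences k"
proof -
  obtain i j where ij: "outside X i j" "minor_outside X = T i j"
    using minor_outside_clique[OF assms(1)] by blast
  then have "min d (count_list (minor_outside X) k) = occurrences k"
    using assms(2) by (auto intro!: count_minor simp: outside_def)
  moreover have "occurrences k < d"
    using assms by (auto simp: threshold_clique_def rare_def)
  ultimately show ?thesis
    by (simp add: min_def split: if_splits)
qed

lemma rare_part_exists:
  "\<exists>t. set t \<subseteq> rare \<and>
    (\<forall>X. clique X \<longrightarrow> filter (\<lambda>v. v \<in> X) t = filter (\<lambda>v. v \<in> X) (minor_outside X))"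
proof (rule threshold_merge)
  show "finite rare"
    by (simp add: rare_def)
  show "set (filter (\<lambda>v. v \<in> X) (minor_outside X)) \<subseteq> X" for X
    by auto
next
  fix X Y
  assume X: "clique X" and Y: "Y \<subseteq> X"
  have KY: "clique Y"
    using threshold_clique_subset[OF X Y] .
  have "filter (\<lambda>v. v \<in> Y) (filter (\<lambda>v. v \<in> X) (minor_outside X)) =
      filter (\<lambda>v. v \<in> Y) (minor_outside X)"
    unfolding filter_filter using Y by (intro filter_cong) auto
  also have "\<dots> = filter (\<lambda>v. v \<in> Y) (minor_outside Y)"
  proof (rule filter_eq_if_pairs)
    show "count_list (minor_outside X) k = count_list (minor_outside Y) k" if "k \<in> Y" for k
      using count_minor_clique[OF X] count_minor_clique[OF KY] that Y by auto
  next
    fix k l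
    assume kl: "k \<in> Y" "l \<in> Y" "k \<noteq> l"
    obtain i j i' j' where ij: "outside X i j" "minor_outside X = T i j"
      "outside Y i' j'" "minor_outside Y = T i' j'"
      using minor_outside_clique[OF X] minor_outside_clique[OF KY] by blast
    show "filter (\<lambda>v. v \<in> {k, l}) (minor_outside X) = filter (\<lambda>v. v \<in> {k, l}) (minor_outside Y)"
      unfolding ij using ij kl Y KY
      by (intro pair_filters_minors_eq) (auto simp: outside_def threshold_clique_def)
  qed
  finally show "filter (\<lambda>v. v \<in> Y) (filter (\<lambda>v. v \<in> X) (minor_outside X)) =
      filter (\<lambda>v. v \<in> Y) (minor_outside Y)" .
qed

text \<open>A variable with \<open>d\<close> occurrences may stand anywhere, since any nonempty word put in for it
  makes the product long. So these variables are appended to the rare part.\<close>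

lemma candidate_term_exists:
  "\<exists>t. set t \<subseteq> {..<n} \<and> (\<forall>k<n. count_list t k = occurrences k) \<and>
    (\<forall>i j k l. k < n \<longrightarrow> l < n \<longrightarrow> k \<noteq> l \<longrightarrow> occurrences k + occurrences l < order_threshold d A \<longrightarrow>
      outside {k, l} i j \<longrightarrow> filter (\<lambda>v. v \<in> {k, l}) t = filter (\<lambda>v. v \<in> {k, l}) (T i j))"
proof -
  obtain t1 where t1: "set t1 \<subseteq> rare"
    "\<And>X. clique X \<Longrightarrow> filter (\<lambda>v. v \<in> X) t1 = filter (\<lambda>v. v \<in> X) (minor_outside X)"
    using rare_part_exists by blast
  define t2 where "t2 = concat (map (replicate d) (filter (\<lambda>k. occurrences k = d) [0..<n]))"
  define t where "t = t1 @ t2"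
  have cnt2: "count_list t2 k = (if k < n \<and> occurrences k = d then d else 0)" for k
    unfolding t2_def by (subst count_list_concat_replicate) auto
  have cnt1: "count_list t1 k = (if k \<in> rare then occurrences k else 0)" for k
  proof (cases "k \<in> rare")
    case True
    have "count_list t1 k = length (filter (\<lambda>v. v \<in> {k}) t1)"
      by (simp add: filter_singleton_eq_replicate)
    also have "\<dots> = length (filter (\<lambda>v. v \<in> {k}) (minor_outside {k}))"
      using t1(2)[OF threshold_clique_singleton[OF True]] by simp
    also have "\<dots> = count_list (minor_outside {k}) k"
      by (simp add: filter_singleton_eq_replicate)
    also have "\<dots> = occurrences k"
      using count_minor_clique[OF threshold_clique_singleton[OF True]] by simp
    finally show ?thesis
      using True by simp
  next
    case False
    then show ?thesis
      using t1(1) by (auto simp: count_list_0_iff)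
  qed
  have cnt: "count_list t k = occurrences k" if "k < n" for k
    using that occurrences_le[of k] by (auto simp: t_def cnt1 cnt2 rare_def)
  have set_t: "set t \<subseteq> {..<n}"
    using t1(1) by (auto simp: t_def t2_def rare_def)
  have pair_t: "filter (\<lambda>v. v \<in> {k, l}) t = filter (\<lambda>v. v \<in> {k, l}) (T i j)"
    if kl: "k < n" "l < n" "k \<noteq> l" and small: "occurrences k + occurrences l < order_threshold d A"
      and ij: "outside {k, l} i j" for i j k l
  proof -
    have lt: "occurrences k < d" "occurrences l < d"
      using small by (auto simp: order_threshold_def split: if_splits)
    have "min d (count_list (T i j) k) = occurrences k" "min d (count_list (T i j) l) = occurrences l"
      using ij by (auto intro!: count_minor simp: outside_def)
    then have cT: "count_list (T i j) k = occurrences k" "count_list (T i j) l = occurrences l"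
      using lt by (auto simp: min_def split: if_splits)
    consider "occurrences k = 0" | "occurrences l = 0" | "k \<in> rare" "l \<in> rare"
      using kl lt by (auto simp: rare_def)
    then show ?thesis
    proof cases
      case 1
      then show ?thesis
        using cT cnt kl by (simp only: filter_pair_absent)
    next
      case 2
      then show ?thesis
        using cT cnt kl by (simp only: filter_pair_absent insert_commute[of k l])
    next
      case 3
      have K: "clique {k, l}"
        using 3 small by (rule threshold_clique_pair)
      obtain i' j' where ij': "outside {k, l} i' j'" "minor_outside {k, l} = T i' j'"
        using minor_outside_clique[OF K] by blast
      have "count_list t2 k = 0" "count_list t2 l = 0"
        using lt by (auto simp: cnt2)
      then have "filter (\<lambda>v. v \<in> {k, l}) t2 = []"
        by (simp only: filter_pair_absent replicate_0)
      then have "filter (\<lambda>v. v \<in> {k, l}) t = filter (\<lambda>v. v \<in> {k, l}) (T i' j')"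
        using t1(2)[OF K] ij'(2) by (simp only: t_def filter_append append_Nil2)
      then show ?thesis
        using pair_filters_minors_eq[OF ij ij'(1) kl(3) small] by simp
    qed
  qed
  show ?thesis
    using set_t cnt pair_t by blast
qed

text \<open>By the pigeonhole principle some two of the other coordinates agree, and the term that
  computes \<open>F\<close> on the tuple does not contain \<open>k\<close>.\<close>

lemma independent_of_absent:
  assumes k: "k < n" "occurrences k = 0" and \<sigma>: "\<And>l. \<sigma> l \<in> lists A"
  shows "F \<sigma> = F (\<sigma>(k := []))"
proof -
  have "card (val ` lists A) < card ({..<n} - {k})"
    using k arity by simp
  then obtain i j where ij: "i < n" "j < n" "i \<noteq> k" "j \<noteq> k" "i \<noteq> j" "val (\<sigma> i) = val (\<sigma> j)"
    using repeated_value[of "{..<n} - {k}" \<sigma>] \<sigma> by auto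
  have "count_list (T i j) k = 0"
    using count_minor[of k i j] ij k d by (auto simp: outside_def)
  then have "evaluate (\<sigma>(k := [])) (T i j) = evaluate \<sigma> (T i j)"
    by (intro arg_cong[where f = concat] map_cong) (auto simp: count_list_0_iff)
  moreover have "F \<sigma> = val (evaluate \<sigma> (T i j))"
    using ij \<sigma> by (intro F_identified) auto
  moreover have "F (\<sigma>(k := [])) = val (evaluate (\<sigma>(k := [])) (T i j))"
    using ij \<sigma> by (intro F_identified) auto
  ultimately show ?thesis
    by simp
qed

text \<open>The candidate term computes \<open>F\<close>. Call a coordinate neutral if it carries the identity or if
  its variable does not occur. With two neutral coordinates the tuple can be changed to one with the
  identity at both, where the term of that minor agrees with the candidate. With at most one, some
  two coordinates \<open>i\<close> and \<open>j\<close> carry equal values, and every variable that is neither \<open>i\<close> nor \<open>j\<close>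
  nor neutral contributes a letter to the products for \<open>T i j\<close> and for the candidate. These are at
  least \<open>n - 3 \<ge> d\<close> variables, so both products are long.\<close>

lemma term_exists:
  "\<exists>t. t \<noteq> [] \<and> set t \<subseteq> {..<n} \<and>
    (\<forall>\<sigma>. (\<forall>k. \<sigma> k \<in> lists A) \<longrightarrow> F \<sigma> = val (concat (map \<sigma> t)))"
proof -
  obtain t where set_t: "set t \<subseteq> {..<n}"
    and cnt: "\<And>k. k < n \<Longrightarrow> count_list t k = occurrences k"
    and pair_t: "\<And>i j k l. k < n \<Longrightarrow> l < n \<Longrightarrow> k \<noteq> l \<Longrightarrow>
      occurrences k + occurrences l < order_threshold d A \<Longrightarrow> outside {k, l} i j \<Longrightarrow>
      filter (\<lambda>v. v \<in> {k, l}) t = filter (\<lambda>v. v \<in> {k, l}) (T i j)"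
    using candidate_term_exists by blast
  have at_two_ones: "F \<sigma> = val (evaluate \<sigma> t)"
    if ij: "i < n" "j < n" "i \<noteq> j" "\<sigma> i = []" "\<sigma> j = []" and \<sigma>: "\<And>k. \<sigma> k \<in> lists A" for \<sigma> i j
  proof -
    define \<tau> where "\<tau> k = (if k < n then \<sigma> k else [])" for k
    let ?P = "{..<n} - {i, j}"
    have \<tau>: "supported_assignment ?P A \<tau>"
      using \<sigma> ij by (auto simp: supported_assignment_def \<tau>_def)
    have e: "evaluate \<tau> s = evaluate \<sigma> s" if "set s \<subseteq> {..<n}" for s
      using that by (intro arg_cong[where f = concat] map_cong) (auto simp: \<tau>_def)
    have "nil_eq d (evaluate \<tau> (T i j)) (evaluate \<tau> t)"
    proof (rule evaluations_eq[OF \<tau>])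
      show "min d (count_list (T i j) k) = min d (count_list t k)" if "k \<in> ?P" for k
        using that count_minor[of k i j] cnt[of k] ij by (simp add: outside_def occurrences_def)
    next
      fix k l
      assume kl: "k \<in> ?P" "l \<in> ?P" "k \<noteq> l"
        "count_list (T i j) k + count_list (T i j) l < order_threshold d A"
      have "occurrences k \<le> count_list (T i j) k" "occurrences l \<le> count_list (T i j) l"
        using count_minor[of k i j] count_minor[of l i j] kl ij by (auto simp: outside_def)
      then show "filter (\<lambda>v. v \<in> {k, l}) (T i j) = filter (\<lambda>v. v \<in> {k, l}) t"
        using kl ij by (intro pair_t[symmetric]) (auto simp: outside_def)
    qed
    then have "nil_eq d (evaluate \<sigma> (T i j)) (evaluate \<sigma> t)"
      using e[of t] e[of "T i j"] set_t T[of i j] ij by simp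
    then show ?thesis
      using F_identified[of i j \<sigma>] ij \<sigma> val_evaluate_eqI by simp
  qed
  have "F \<sigma> = val (evaluate \<sigma> t)" if \<sigma>: "\<And>k. \<sigma> k \<in> lists A" for \<sigma>
  proof -
    define Z where "Z = {k. k < n \<and> (\<sigma> k = [] \<or> occurrences k = 0)}"
    have drop: "F \<rho> = F (\<rho>(k := []))" if "k \<in> Z" "\<And>l. \<rho> l \<in> lists A" "\<rho> k = \<sigma> k" for \<rho> k
    proof (cases "\<rho> k = []")
      case True
      then show ?thesis
        by (metis fun_upd_triv)
    next
      case False
      then show ?thesis
        using that independent_of_absent[of k \<rho>] by (auto simp: Z_def)
    qed
    show ?thesis
    proof (cases "\<exists>i\<in>Z. \<exists>j\<in>Z. i \<noteq> j")
      case True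
      then obtain i j where ij: "i \<in> Z" "j \<in> Z" "i \<noteq> j"
        by blast
      let ?\<rho> = "\<sigma>(i := [], j := [])"
      have "F \<sigma> = F ?\<rho>"
        using drop[of i \<sigma>] drop[of j "\<sigma>(i := [])"] ij \<sigma> by auto
      also have "\<dots> = val (evaluate ?\<rho> t)"
        using ij \<sigma> by (intro at_two_ones[of i j]) (auto simp: Z_def)
      also have "evaluate ?\<rho> t = evaluate \<sigma> t"
      proof (intro arg_cong[where f = concat] map_cong refl)
        fix k assume "k \<in> set t"
        moreover from this have "k < n"
          using set_t by auto
        ultimately have "k < n" "occurrences k \<noteq> 0"
          using cnt[of k] count_list_0_iff[of t k] by auto
        then show "?\<rho> k = \<sigma> k"
          using ij by (auto simp: Z_def)
      qed
      finally show ?thesis .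
    next
      case False
      obtain i j where ij: "i < n" "j < n" "i \<noteq> j" "val (\<sigma> i) = val (\<sigma> j)"
        using repeated_value[of "{..<n}" \<sigma>] \<sigma> arity by auto
      define U where "U = {..<n} - Z - {i, j}"
      have "finite Z"
        by (simp add: Z_def)
      then have "card Z \<le> 1"
        using False by (simp add: card_le_Suc0_iff_eq)
      moreover have "n - card Z \<le> card ({..<n} - Z)"
        using diff_card_le_card_Diff[OF \<open>finite Z\<close>, of "{..<n}"] by simp
      moreover have "card ({..<n} - Z) - card {i, j} \<le> card U"
        unfolding U_def by (rule diff_card_le_card_Diff) simp
      ultimately have U: "d \<le> card U"
        using arity card_values_ge ij by simp
      have "card U \<le> length (evaluate \<sigma> (T i j))"
      proof (rule card_le_length_concat)
        show "k \<in> set (T i j) \<and> \<sigma> k \<noteq> []" if "k \<in> U" for k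
          using that count_minor[of k i j] ij count_list_0_iff[of "T i j" k]
          by (auto simp: U_def Z_def outside_def)
      qed (simp add: U_def)
      moreover have "card U \<le> length (evaluate \<sigma> t)"
      proof (rule card_le_length_concat)
        show "k \<in> set t \<and> \<sigma> k \<noteq> []" if "k \<in> U" for k
          using that cnt[of k] count_list_0_iff[of t k] by (auto simp: U_def Z_def)
      qed (simp add: U_def)
      ultimately have "nil_eq d (evaluate \<sigma> (T i j)) (evaluate \<sigma> t)"
        using U by (simp add: nil_eq_def)
      then show ?thesis
        using F_identified[of i j \<sigma>] ij \<sigma> val_evaluate_eqI by simp
    qed
  qed
  \<comment> \<open>The term \<open>T 0 1\<close> is nonempty. If no variable occurred in \<open>t\<close>, it could contain only the variables
    \<open>0\<close> and \<open>1\<close>. Their occurrences show with the identity at \<open>2\<close> and \<open>3\<close>, where \<open>t\<close> gives the identity.\<close>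
  moreover have "t \<noteq> []"
  proof
    assume "t = []"
    have n4: "4 \<le> n"
      using arity card_values_ge d by simp
    obtain k where k: "k \<in> set (T 0 1)" "k < n"
      using T[of 0 1] n4 by (cases "T 0 1") auto
    have "occurrences k = 0"
      using cnt[OF k(2)] \<open>t = []\<close> by simp
    have "k = 0 \<or> k = 1"
    proof (rule ccontr)
      assume "\<not> (k = 0 \<or> k = 1)"
      then have "min d (count_list (T 0 1) k) = 0"
        using count_minor[of k 0 1] \<open>occurrences k = 0\<close> n4 by (simp add: outside_def)
      then show False
        using k d count_list_0_iff[of "T 0 1" k] by (auto simp: min_def split: if_splits)
    qed
    let ?\<sigma> = "\<lambda>v::nat. if v = 0 \<or> v = 1 then [a] else []"
    have \<sigma>: "\<And>v. ?\<sigma> v \<in> lists A"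
      using a by simp
    have "F ?\<sigma> = val (evaluate ?\<sigma> (T 0 1))"
      using n4 \<sigma> by (intro F_identified) auto
    moreover have "F ?\<sigma> = val (evaluate ?\<sigma> t)"
      using n4 \<sigma> by (intro at_two_ones[of 2 3]) auto
    ultimately have "nil_eq d (evaluate ?\<sigma> (T 0 1)) []"
      using val[of "evaluate ?\<sigma> (T 0 1)" "[]"] evaluate_in_lists[OF \<sigma>] \<open>t = []\<close> by simp
    then have "evaluate ?\<sigma> (T 0 1) = []"
      using d by (simp add: nil_eq_def)
    then show False
      using k \<open>k = 0 \<or> k = 1\<close> by auto
  qed
  ultimately show ?thesis
    using set_t by blast
qed

end

section \<open>The degree bound for the monoid\<close>

definition word_value :: "nat \<Rightarrow> 'a set \<Rightarrow> 'a list \<Rightarrow> 'a list set option" where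
  "word_value d A w = (if w = [] then None
     else Some (rees_congruence (free_semigroup A) (long_words d A) `` {w}))"

lemma word_value_eq_iff:
  assumes "A \<noteq> {}" "1 \<le> d" "u \<in> lists A" "w \<in> lists A"
  shows "word_value d A u = word_value d A w \<longleftrightarrow> nil_eq d u w"
proof (cases "u = [] \<or> w = []")
  case True
  then show ?thesis
    using assms(2) by (auto simp: word_value_def nil_eq_def)
next
  case False
  let ?r = "rees_congruence (free_semigroup A) (long_words d A)"
  have "equiv (carrier (free_semigroup A)) ?r"
    by (intro equiv_rees_congruence long_words_ideal assms)
  moreover have "u \<in> carrier (free_semigroup A)" "w \<in> carrier (free_semigroup A)"
    using False assms by (auto simp: free_semigroup_def)
  ultimately have "?r `` {u} = ?r `` {w} \<longleftrightarrow> (u, w) \<in> ?r"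
    by (simp add: eq_equiv_class_iff)
  then show ?thesis
    using False assms
    by (auto simp: word_value_def nil_eq_def rees_congruence_def long_words_def free_semigroup_def)
qed

lemma operations_undefined: "f \<in> operations C n \<Longrightarrow> xs \<notin> tuples C n \<Longrightarrow> f xs = undefined"
  unfolding operations_def by (rule PiE_arb)

context
  fixes A :: "'a set" and d :: nat and S :: "'a list set option sgrp"
  assumes A: "A \<noteq> {}" and d: "1 \<le> d" and S: "S = adjoin_one (free_nilpotent d A)"
begin

lemma carrier_eq_word_values: "carrier S = word_value d A ` lists A"
proof
  show "carrier S \<subseteq> word_value d A ` lists A"
    by (force simp: S adjoin_one_def free_nilpotent_def rees_quotient_def quotient_def
        free_semigroup_def word_value_def image_iff)
  show "word_value d A ` lists A \<subseteq> carrier S"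
    by (auto simp: S adjoin_one_def free_nilpotent_def rees_quotient_def quotient_def
        free_semigroup_def word_value_def)
qed

lemma mult_word_value:
  assumes "u \<in> lists A" "w \<in> lists A"
  shows "sg_mult S (word_value d A u) (word_value d A w) = word_value d A (u @ w)"
proof (cases "u = [] \<or> w = []")
  case True
  then show ?thesis
    by (cases "u = []") (simp_all add: S adjoin_one_def word_value_def)
next
  case False
  then have "u \<in> carrier (free_semigroup A)" "w \<in> carrier (free_semigroup A)"
    using assms by (auto simp: free_semigroup_def)
  note sg_mult_rees_quotient[OF is_semigroup_free_semigroup long_words_ideal[OF A] this, of d]
  then show ?thesis
    using False
    by (simp add: S adjoin_one_def word_value_def free_nilpotent_def)
      (simp add: free_semigroup_def)
qed

lemma finite_carrier:
  assumes "finite A"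
  shows "finite (carrier S)"
proof -
  obtain a where a: "a \<in> A"
    using A by blast
  have "word_value d A w \<in> word_value d A ` {w. set w \<subseteq> A \<and> length w \<le> d}" if "w \<in> lists A" for w
  proof (cases "length w \<le> d")
    case True
    then show ?thesis
      using that by auto
  next
    case False
    have "word_value d A w = word_value d A (replicate d a)"
      using False that a by (subst word_value_eq_iff[OF A d]) (auto simp: nil_eq_def)
    then show ?thesis
      using a by auto
  qed
  then have "carrier S \<subseteq> word_value d A ` {w. set w \<subseteq> A \<and> length w \<le> d}"
    by (auto simp: carrier_eq_word_values)
  then show ?thesis
    by (rule finite_subset) (intro finite_imageI finite_lists_length_le assms)
qed

lemma is_semigroup_monoid: "is_semigroup S"
  by (auto simp: is_semigroup_def carrier_eq_word_values mult_word_value)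

lemma eval_term_word_values:
  assumes "\<And>k. \<sigma> k \<in> lists A" "t \<noteq> []" "set t \<subseteq> {..<n}"
  shows "eval_term S t (map (\<lambda>k. word_value d A (\<sigma> k)) [0..<n]) =
    word_value d A (concat (map \<sigma> t))"
  using assms(2,3)
proof (induction t rule: induct_list012)
  case (3 v w t)
  have "concat (map \<sigma> (w # t)) \<in> lists A"
    using assms(1) unfolding in_lists_conv_set by auto
  then show ?case
    using 3 assms(1) by (simp add: mult_word_value)
qed auto

lemma degree_bound_monoid:
  assumes fin: "finite A"
  shows "degree_bound S (card (carrier S) + 1)"
  unfolding degree_bound_def
proof (intro allI ballI impI)
  let ?C = "carrier S"
  let ?val = "word_value d A"
  fix n f
  assume n: "card ?C + 1 < n" and f: "f \<in> operations ?C n"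
    and minors: "\<forall>i j. i < j \<and> j < n \<longrightarrow> identify_args ?C n i j f \<in> term_functions S n"
  obtain a where a: "a \<in> A"
    using A by blast
  have "\<exists>t. t \<noteq> [] \<and> set t \<subseteq> {..<n} \<and>
      (\<forall>xs \<in> tuples ?C n. xs ! i = xs ! j \<longrightarrow> f xs = eval_term S t xs)"
    if "i < n" "j < n" "i \<noteq> j" for i j
    using that
  proof (induction i j rule: linorder_wlog)
    case (le i j)
    then have "identify_args ?C n i j f \<in> term_functions S n"
      using minors by simp
    then obtain t where t: "t \<in> sg_terms n"
      "identify_args ?C n i j f = (\<lambda>xs \<in> tuples ?C n. eval_term S t xs)"
      unfolding term_functions_def by blast
    \<comment> \<open>On a tuple with equal entries at \<open>i\<close> and \<open>j\<close>, the identification minor is \<open>f\<close> itself.\<close>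
    have "f xs = eval_term S t xs" if "xs \<in> tuples ?C n" "xs ! i = xs ! j" for xs
    proof -
      have "xs[i := xs ! j] = xs"
        using that(2) by (metis list_update_id)
      then show ?thesis
        using fun_cong[OF t(2), of xs] that(1) by (simp add: identify_args_def)
    qed
    then show ?case
      using t(1) by (intro exI[of _ t]) (auto simp: sg_terms_def free_semigroup_def)
  next
    case (sym i j)
    then show ?case
      by metis
  qed
  then obtain T where T: "\<And>i j. i < n \<Longrightarrow> j < n \<Longrightarrow> i \<noteq> j \<Longrightarrow> T i j \<noteq> [] \<and> set (T i j) \<subseteq> {..<n} \<and>
      (\<forall>xs \<in> tuples ?C n. xs ! i = xs ! j \<longrightarrow> f xs = eval_term S (T i j) xs)"
    by metis
  let ?xs = "\<lambda>\<sigma>. map (\<lambda>k. ?val (\<sigma> k)) [0..<n]"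
  have tup: "?xs \<sigma> \<in> tuples ?C n" if "\<And>k. \<sigma> k \<in> lists A" for \<sigma>
    using that by (auto simp: tuples_def carrier_eq_word_values)
  have "\<exists>t. t \<noteq> [] \<and> set t \<subseteq> {..<n} \<and>
      (\<forall>\<sigma>. (\<forall>k. \<sigma> k \<in> lists A) \<longrightarrow> f (?xs \<sigma>) = ?val (concat (map \<sigma> t)))"
  proof (intro identification_minors.term_exists identification_minors.intro)
    show "a \<in> A" "1 \<le> d" by fact+
    show "?val u = ?val w \<longleftrightarrow> nil_eq d u w" if "u \<in> lists A" "w \<in> lists A" for u w
      using word_value_eq_iff[OF A d that] .
    show "finite (?val ` lists A)"
      using finite_carrier[OF fin] by (simp add: carrier_eq_word_values)
    show "card (?val ` lists A) + 2 \<le> n"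
      using n by (simp add: carrier_eq_word_values)
    show "T i j \<noteq> [] \<and> set (T i j) \<subseteq> {..<n}" if "i < n" "j < n" "i \<noteq> j" for i j
      using T[OF that] by blast
    show "f (?xs \<sigma>) = ?val (concat (map \<sigma> (T i j)))"
      if "i < n" "j < n" "i \<noteq> j" "\<And>k. \<sigma> k \<in> lists A" "?val (\<sigma> i) = ?val (\<sigma> j)" for i j \<sigma>
      using T[OF that(1-3)] tup[of \<sigma>] that eval_term_word_values[of \<sigma> "T i j" n] by simp
  qed
  then obtain t where t: "t \<noteq> []" "set t \<subseteq> {..<n}"
    and ft: "\<And>\<sigma>. (\<And>k. \<sigma> k \<in> lists A) \<Longrightarrow> f (?xs \<sigma>) = ?val (concat (map \<sigma> t))"
    by blast
  have "f = (\<lambda>xs \<in> tuples ?C n. eval_term S t xs)"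
  proof
    fix xs
    show "f xs = (\<lambda>xs \<in> tuples ?C n. eval_term S t xs) xs"
    proof (cases "xs \<in> tuples ?C n")
      case True
      have "\<exists>w\<in>lists A. k < n \<longrightarrow> xs ! k = ?val w" for k
      proof (cases "k < n")
        case True
        then have "xs ! k \<in> ?C"
          using \<open>xs \<in> tuples ?C n\<close> nth_mem[of k xs] by (auto simp: tuples_def)
        then show ?thesis
          by (auto simp: carrier_eq_word_values)
      qed (use lists.Nil in blast)
      then obtain \<sigma> where \<sigma>: "\<And>k. \<sigma> k \<in> lists A" "\<And>k. k < n \<Longrightarrow> xs ! k = ?val (\<sigma> k)"
        by metis
      have "xs = ?xs \<sigma>"
        using True \<sigma>(2) by (intro nth_equalityI) (auto simp: tuples_def)
      then show ?thesis
        using ft[of \<sigma>] eval_term_word_values[of \<sigma> t n] \<sigma>(1) t True by simp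
    next
      case False
      then show ?thesis
        using operations_undefined[OF f] by simp
    qed
  qed
  then show "f \<in> term_functions S n"
    using t by (auto simp: term_functions_def sg_terms_def free_semigroup_def)
qed

end

section \<open>A degree bound implies finite relatedness\<close>

lemma sg_terms_iff: "t \<in> sg_terms n \<longleftrightarrow> t \<noteq> [] \<and> set t \<subseteq> {..<n}"
  by (auto simp: sg_terms_def free_semigroup_def)

lemma tuples_iff: "xs \<in> tuples C n \<longleftrightarrow> set xs \<subseteq> C \<and> length xs = n"
  by (auto simp: tuples_def)

lemma eval_term_closed:
  assumes "is_semigroup S" "xs \<in> tuples (carrier S) n" "t \<in> sg_terms n"
  shows "eval_term S t xs \<in> carrier S"
  using assms(3)
proof (induction t rule: induct_list012)
  case (2 v)
  then show ?case
    using assms(2) nth_mem[of v xs] by (auto simp: sg_terms_iff tuples_iff)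
next
  case (3 v w t)
  have "xs ! v \<in> carrier S"
    using 3(3) assms(2) nth_mem[of v xs] by (auto simp: sg_terms_iff tuples_iff)
  then show ?case
    using 3 assms(1) by (simp add: sg_terms_iff is_semigroup_def)
qed (simp add: sg_terms_iff)

lemma eval_term_append:
  assumes S: "is_semigroup S" and xs: "xs \<in> tuples (carrier S) n"
    and "u \<in> sg_terms n" "w \<in> sg_terms n"
  shows "eval_term S (u @ w) xs = sg_mult S (eval_term S u xs) (eval_term S w xs)"
  using assms(3)
proof (induction u rule: induct_list012)
  case (2 v)
  then show ?case
    using assms(4) by (cases w) (auto simp: sg_terms_iff)
next
  case (3 v v' u)
  have "xs ! v \<in> carrier S"
    using 3(3) xs nth_mem[of v xs] by (auto simp: sg_terms_iff tuples_iff)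
  moreover have "v' # u \<in> sg_terms n"
    using 3(3) by (simp add: sg_terms_iff)
  moreover note eval_term_closed[OF S xs this] eval_term_closed[OF S xs assms(4)]
  ultimately show ?case
    using 3 S by (simp add: is_semigroup_def)
qed (simp add: sg_terms_iff)

lemma concat_in_sg_terms:
  assumes "t \<in> sg_terms n" "\<And>j. j < n \<Longrightarrow> \<tau> j \<in> sg_terms k"
  shows "concat (map \<tau> t) \<in> sg_terms k"
  using assms unfolding sg_terms_iff by (cases t) (simp, fastforce)

lemma eval_term_substitute:
  assumes S: "is_semigroup S" and xs: "xs \<in> tuples (carrier S) k"
    and \<tau>: "\<And>j. j < n \<Longrightarrow> \<tau> j \<in> sg_terms k" and t: "t \<in> sg_terms n"
  shows "eval_term S (concat (map \<tau> t)) xs = eval_term S t (map (\<lambda>j. eval_term S (\<tau> j) xs) [0..<n])"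
  using t
proof (induction t rule: induct_list012)
  case (3 v w t)
  have "\<tau> v \<in> sg_terms k"
    using \<tau> 3(3) by (simp add: sg_terms_iff)
  moreover have "concat (map \<tau> (w # t)) \<in> sg_terms k"
    using \<tau> 3(3) by (intro concat_in_sg_terms[of _ n]) (auto simp: sg_terms_iff)
  ultimately show ?case
    using 3 eval_term_append[OF S xs, of "\<tau> v" "concat (map \<tau> (w # t))"]
    by (simp add: sg_terms_iff)
qed (simp_all add: sg_terms_iff)

lemma eval_term_rename:
  assumes "t \<in> sg_terms m"
  shows "eval_term S (map \<rho> t) xs = eval_term S t (map (\<lambda>v. xs ! \<rho> v) [0..<m])"
  using assms by (induction t rule: induct_list012) (simp_all add: sg_terms_iff)

lemma term_functions_in_operations:
  "is_semigroup S \<Longrightarrow> term_functions S n \<subseteq> operations (carrier S) n"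
  by (auto simp: term_functions_def operations_def intro: eval_term_closed)

lemma eval_term_of_term_functions:
  assumes S: "is_semigroup S" and t: "t \<in> sg_terms n" and gs: "gs \<in> tuples (term_functions S k) n"
  shows "(\<lambda>xs \<in> tuples (carrier S) k. eval_term S t (map (\<lambda>g. g xs) gs)) \<in> term_functions S k"
proof -
  have "\<exists>s\<in>sg_terms k. gs ! j = (\<lambda>xs \<in> tuples (carrier S) k. eval_term S s xs)" if "j < n" for j
  proof -
    have "gs ! j \<in> term_functions S k"
      using gs that by (auto simp: tuples_iff)
    then show ?thesis
      unfolding term_functions_def by blast
  qed
  then obtain \<tau> where \<tau>: "\<And>j. j < n \<Longrightarrow> \<tau> j \<in> sg_terms k"
    "\<And>j. j < n \<Longrightarrow> gs ! j = (\<lambda>xs \<in> tuples (carrier S) k. eval_term S (\<tau> j) xs)"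
    by metis
  have "eval_term S t (map (\<lambda>g. g xs) gs) = eval_term S (concat (map \<tau> t)) xs"
    if xs: "xs \<in> tuples (carrier S) k" for xs
  proof -
    have "map (\<lambda>g. g xs) gs = map (\<lambda>j. eval_term S (\<tau> j) xs) [0..<n]"
      using gs \<tau>(2) xs by (intro nth_equalityI) (auto simp: tuples_iff)
    then show ?thesis
      using eval_term_substitute[OF S xs \<tau>(1) t] by simp
  qed
  moreover have "concat (map \<tau> t) \<in> sg_terms k"
    using t \<tau>(1) concat_in_sg_terms by blast
  ultimately show ?thesis
    unfolding term_functions_def by (intro image_eqI[of _ _ "concat (map \<tau> t)"] restrict_ext) auto
qed

definition compose_terms ::
    "('a, 'm) sgrp_scheme \<Rightarrow> nat \<Rightarrow> ('a list \<Rightarrow> 'a) \<Rightarrow> ('a list \<Rightarrow> 'a) list \<Rightarrow> 'a list \<Rightarrow> 'a" where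
  "compose_terms S k f gs = (\<lambda>xs \<in> tuples (carrier S) k. f (map (\<lambda>g. g xs) gs))"

lemma map_eval_in_tuples:
  assumes "is_semigroup S" "gs \<in> tuples (term_functions S k) n" "xs \<in> tuples (carrier S) k"
  shows "map (\<lambda>g. g xs) gs \<in> tuples (carrier S) n"
proof -
  have "g xs \<in> carrier S" if "g \<in> set gs" for g
    using that assms term_functions_in_operations[OF assms(1), of k]
    by (auto simp: tuples_iff operations_def PiE_iff subset_iff)
  then show ?thesis
    using assms(2) by (auto simp: tuples_iff)
qed

text \<open>A \<open>k\<close>-ary operation is recorded as the list of its values on an enumeration \<open>es\<close> of all
  \<open>k\<close>-tuples. In this encoding, applying \<open>f\<close> to rows entrywise is composition.\<close>

lemma preserves_term_graph_iff:
  assumes S: "is_semigroup S" and es: "set es = tuples (carrier S) k"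
  shows "preserves n f (length es, (\<lambda>g. map g es) ` term_functions S k) \<longleftrightarrow>
    (\<forall>gs \<in> tuples (term_functions S k) n. compose_terms S k f gs \<in> term_functions S k)"
proof -
  have ext: "compose_terms S k f gs \<in> term_functions S k \<longleftrightarrow>
      map (compose_terms S k f gs) es \<in> (\<lambda>g. map g es) ` term_functions S k" for gs
  proof
    assume "map (compose_terms S k f gs) es \<in> (\<lambda>g. map g es) ` term_functions S k"
    then obtain g where g: "g \<in> term_functions S k" "map (compose_terms S k f gs) es = map g es"
      by blast
    have "compose_terms S k f gs = g"
    proof
      fix xs
      show "compose_terms S k f gs xs = g xs"
      proof (cases "xs \<in> set es")
        case True
        then show ?thesis
          using g(2) by (simp only: map_eq_conv)
      next
        case False
        moreover have "g \<in> operations (carrier S) k"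
          using g(1) term_functions_in_operations[OF S] by blast
        ultimately show ?thesis
          unfolding es by (simp add: compose_terms_def operations_undefined[of g "carrier S" k])
      qed
    qed
    then show "compose_terms S k f gs \<in> term_functions S k"
      using g by simp
  qed blast
  have row: "map (\<lambda>i. f (map (\<lambda>r. r ! i) (map (\<lambda>g. map g es) gs))) [0..<length es] =
      map (compose_terms S k f gs) es" for gs :: "('a list \<Rightarrow> 'a) list"
  proof (rule nth_equalityI)
    fix i
    assume "i < length (map (\<lambda>i. f (map (\<lambda>r. r ! i) (map (\<lambda>g. map g es) gs))) [0..<length es])"
    then have i: "i < length es"
      by simp
    then have "es ! i \<in> tuples (carrier S) k"
      using es nth_mem by blast
    then show "map (\<lambda>i. f (map (\<lambda>r. r ! i) (map (\<lambda>g. map g es) gs))) [0..<length es] ! i =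
        map (compose_terms S k f gs) es ! i"
      using i by (simp add: compose_terms_def comp_def)
  qed simp
  have "tuples ((\<lambda>g. map g es) ` term_functions S k) n =
      map (\<lambda>g. map g es) ` tuples (term_functions S k) n"
    unfolding tuples_def lists_image by auto
  then have "preserves n f (length es, (\<lambda>g. map g es) ` term_functions S k) \<longleftrightarrow>
      (\<forall>gs \<in> tuples (term_functions S k) n.
        map (compose_terms S k f gs) es \<in> (\<lambda>g. map g es) ` term_functions S k)"
    unfolding preserves_def by (simp only: prod.case ball_simps row)
  then show ?thesis
    by (simp only: ext)
qed

text \<open>For \<open>n \<le> k\<close>, substituting the first \<open>n\<close> projections of arity \<open>k\<close> shows that \<open>f\<close>, with dummy
  variables added, is a term function. For \<open>n > k\<close> an identification minor is, up to a dummy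
  variable, an operation of arity \<open>n - 1\<close> that inherits the closure property, so that the induction
  hypothesis and the degree bound apply.\<close>

lemma term_function_if_degree_bound:
  assumes S: "is_semigroup S" and k: "1 \<le> k" and deg: "degree_bound S k"
    and "1 \<le> n" "f \<in> operations (carrier S) n"
    and "\<And>gs. gs \<in> tuples (term_functions S k) n \<Longrightarrow> compose_terms S k f gs \<in> term_functions S k"
  shows "f \<in> term_functions S n"
  using assms(4-)
proof (induction n arbitrary: f rule: less_induct)
  case (less n f)
  let ?C = "carrier S"
  note f = less.prems(2) and inv = less.prems(3)
  show ?case
  proof (cases "n \<le> k")
    case True
    define \<pi> where "\<pi> m = (\<lambda>xs \<in> tuples ?C k. xs ! m)" for m
    have "\<pi> m \<in> term_functions S k" if "m < n" for m
      unfolding \<pi>_def term_functions_def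
      by (rule image_eqI[of _ _ "[m]"]) (use that True in \<open>auto simp: sg_terms_iff\<close>)
    then have "compose_terms S k f (map \<pi> [0..<n]) \<in> term_functions S k"
      by (intro inv) (auto simp: tuples_iff)
    then obtain t where t: "t \<in> sg_terms k"
      "compose_terms S k f (map \<pi> [0..<n]) = (\<lambda>xs \<in> tuples ?C k. eval_term S t xs)"
      by (auto simp: term_functions_def)
    \<comment> \<open>The dummy variables are replaced by the first variable.\<close>
    define \<rho> where "\<rho> v = (if v < n then v else 0)" for v
    have "f = (\<lambda>xs \<in> tuples ?C n. eval_term S (map \<rho> t) xs)"
    proof
      fix xs
      show "f xs = (\<lambda>xs \<in> tuples ?C n. eval_term S (map \<rho> t) xs) xs"
      proof (cases "xs \<in> tuples ?C n")
        case xs: True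
        let ?ys = "map (\<lambda>v. xs ! \<rho> v) [0..<k]"
        have "xs ! \<rho> v \<in> ?C" for v
        proof -
          have "\<rho> v < length xs"
            using xs less.prems(1) by (auto simp: tuples_iff \<rho>_def)
          then show ?thesis
            using xs nth_mem[of "\<rho> v" xs] by (auto simp: tuples_iff)
        qed
        then have ys: "?ys \<in> tuples ?C k"
          by (auto simp: tuples_iff)
        have "map (\<lambda>g. g ?ys) (map \<pi> [0..<n]) = xs"
          using xs ys True by (intro nth_equalityI) (auto simp: \<pi>_def tuples_iff \<rho>_def)
        then have "f xs = compose_terms S k f (map \<pi> [0..<n]) ?ys"
          using ys by (simp only: compose_terms_def restrict_apply' )
        also have "\<dots> = eval_term S (map \<rho> t) xs"
          using ys by (simp add: t(2) eval_term_rename[OF t(1)])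
        finally show ?thesis
          using xs by simp
      qed (use operations_undefined[OF f] in simp)
    qed
    moreover have "map \<rho> t \<in> sg_terms n"
      using t(1) less.prems(1) by (auto simp: sg_terms_iff \<rho>_def)
    ultimately show ?thesis
      unfolding term_functions_def by blast
  next
    case False
    have "identify_args ?C n i j f \<in> term_functions S n" if ij: "i < j" "j < n" for i j
    proof -
      \<comment> \<open>Coordinate \<open>i\<close> is deleted by \<open>\<delta>\<close>; by \<open>\<rho>\<close> it is filled with a copy of coordinate \<open>j\<close>, which after
        the deletion has index \<open>j - 1\<close>.\<close>
      define \<rho> where "\<rho> v = (if v = i then j - 1 else if v < i then v else v - 1)" for v
      define \<delta> where "\<delta> u = (if u < i then u else u + 1)" for u :: nat
      let ?in = "\<lambda>ys. map (\<lambda>v. ys ! \<rho> v) [0..<n]"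
      define h where "h = (\<lambda>ys \<in> tuples ?C (n - 1). f (?in ys))"
      have \<rho>_less: "\<rho> v < n - 1" if "v < n" for v
        using that ij by (auto simp: \<rho>_def)
      have in_tuples: "?in ys \<in> tuples B n" if "ys \<in> tuples B (n - 1)" for B :: "'z set" and ys
        using that \<rho>_less nth_mem[of _ ys] by (fastforce simp: tuples_iff)
      have h: "h \<in> operations ?C (n - 1)"
        using in_tuples f by (auto simp: h_def operations_def)
      have "h \<in> term_functions S (n - 1)"
      proof (rule less.IH)
        show "n - 1 < n" "1 \<le> n - 1"
          using False k by auto
        show "h \<in> operations ?C (n - 1)" by fact
        fix gs
        assume gs: "gs \<in> tuples (term_functions S k) (n - 1)"
        have "compose_terms S k h gs = compose_terms S k f (?in gs)"
          unfolding compose_terms_def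
        proof (rule restrict_ext)
          fix xs
          assume xs: "xs \<in> tuples ?C k"
          have "h (map (\<lambda>g. g xs) gs) = f (?in (map (\<lambda>g. g xs) gs))"
            using map_eval_in_tuples[OF S gs xs] by (simp add: h_def)
          also have "?in (map (\<lambda>g. g xs) gs) = map (\<lambda>g. g xs) (?in gs)"
            using gs \<rho>_less by (simp add: tuples_iff)
          finally show "h (map (\<lambda>g. g xs) gs) = f (map (\<lambda>g. g xs) (?in gs))" .
        qed
        then show "compose_terms S k h gs \<in> term_functions S k"
          using inv in_tuples[OF gs] by simp
      qed
      then obtain t where t: "t \<in> sg_terms (n - 1)" "h = (\<lambda>xs \<in> tuples ?C (n - 1). eval_term S t xs)"
        by (auto simp: term_functions_def)
      have "identify_args ?C n i j f = (\<lambda>xs \<in> tuples ?C n. eval_term S (map \<delta> t) xs)"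
        unfolding identify_args_def
      proof (rule restrict_ext)
        fix xs
        assume xs: "xs \<in> tuples ?C n"
        let ?ys = "map (\<lambda>u. xs ! \<delta> u) [0..<n - 1]"
        have "\<delta> u < n" if "u < n - 1" for u
          using that by (auto simp: \<delta>_def)
        then have ys: "?ys \<in> tuples ?C (n - 1)"
          using xs nth_mem[of _ xs] by (fastforce simp: tuples_iff)
        have "xs[i := xs ! j] ! v = ?ys ! \<rho> v" if "v < n" for v
          using that \<rho>_less[OF that] ij xs by (auto simp: \<rho>_def \<delta>_def tuples_iff nth_list_update)
        then have "xs[i := xs ! j] = ?in ?ys"
          using xs by (intro nth_equalityI) (auto simp: tuples_iff)
        then have "f (xs[i := xs ! j]) = h ?ys"
          using ys by (simp add: h_def)
        also have "\<dots> = eval_term S (map \<delta> t) xs"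
          using ys by (simp add: t(2) eval_term_rename[OF t(1)])
        finally show "f (xs[i := xs ! j]) = eval_term S (map \<delta> t) xs" .
      qed
      moreover have "map \<delta> t \<in> sg_terms n"
        using t(1) by (auto simp: sg_terms_iff \<delta>_def)
      ultimately show ?thesis
        unfolding term_functions_def by blast
    qed
    then show ?thesis
      using deg f False by (simp add: degree_bound_def)
  qed
qed

lemma finitely_related_if_degree_bound:
  assumes S: "is_semigroup S" and fin: "finite (carrier S)" and ne: "carrier S \<noteq> {}"
    and k: "1 \<le> k" and deg: "degree_bound S k"
  shows "finitely_related S"
proof -
  let ?C = "carrier S"
  have "tuples ?C k = {xs. set xs \<subseteq> ?C \<and> length xs = k}"
    by (auto simp: tuples_iff)
  then have "finite (tuples ?C k)"
    using fin by (simp add: finite_lists_length_eq)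
  then obtain es where es: "set es = tuples ?C k"
    using finite_list by blast
  obtain x where "x \<in> ?C"
    using ne by blast
  then have "replicate k x \<in> set es"
    using es by (auto simp: tuples_iff)
  then have len: "1 \<le> length es"
    by (cases es) auto
  let ?\<Gamma> = "(\<lambda>g. map g es) ` term_functions S k"
  have \<Gamma>: "?\<Gamma> \<subseteq> tuples ?C (length es)"
    using term_functions_in_operations[OF S, of k] es
    by (fastforce simp: tuples_iff operations_def)
  have "term_functions S n = {f \<in> operations ?C n. preserves n f (length es, ?\<Gamma>)}" if n: "1 \<le> n" for n
  proof (intro equalityI subsetI)
    fix f
    assume "f \<in> term_functions S n"
    then obtain t where t: "t \<in> sg_terms n" "f = (\<lambda>xs \<in> tuples ?C n. eval_term S t xs)"
      by (auto simp: term_functions_def)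
    have "compose_terms S k f gs \<in> term_functions S k" if gs: "gs \<in> tuples (term_functions S k) n" for gs
    proof -
      have "compose_terms S k f gs = (\<lambda>xs \<in> tuples ?C k. eval_term S t (map (\<lambda>g. g xs) gs))"
        unfolding compose_terms_def t(2)
        using map_eval_in_tuples[OF S gs] by (intro restrict_ext) simp
      then show ?thesis
        using eval_term_of_term_functions[OF S t(1) gs] by simp
    qed
    then show "f \<in> {f \<in> operations ?C n. preserves n f (length es, ?\<Gamma>)}"
      using term_functions_in_operations[OF S, of n] \<open>f \<in> term_functions S n\<close>
      by (auto simp: preserves_term_graph_iff[OF S es])
  next
    fix f
    assume "f \<in> {f \<in> operations ?C n. preserves n f (length es, ?\<Gamma>)}"
    then show "f \<in> term_functions S n"
      using term_function_if_degree_bound[OF S k deg n]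
      by (auto simp: preserves_term_graph_iff[OF S es])
  qed
  then show ?thesis
    unfolding finitely_related_def using len \<Gamma>
    by (intro exI[of _ "{(length es, ?\<Gamma>)}"]) auto
qed

theorem theorem2p4:
  fixes A :: "'a set" and d :: nat and S :: "'a list set option sgrp"
  assumes "finite A" and "A \<noteq> {}" and "d \<ge> 1"
    and "S = adjoin_one (free_nilpotent d A)"
  shows "finitely_related S \<and> (\<exists>k. has_degree S k \<and> k \<le> card (carrier S) + 1)"
proof -
  let ?k = "card (carrier S) + 1"
  have bound: "degree_bound S ?k"
    using degree_bound_monoid[OF assms(2,3,4,1)] .
  have "finitely_related S"
    using is_semigroup_monoid[OF assms(2-4)] finite_carrier[OF assms(2,3,4,1)] _ _ bound
    by (rule finitely_related_if_degree_bound)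
      (auto simp: carrier_eq_word_values[OF assms(2-4)])
  moreover define k where "k = (LEAST k. 1 \<le> k \<and> degree_bound S k)"
  have "1 \<le> k \<and> degree_bound S k"
    unfolding k_def by (rule LeastI[of _ ?k]) (use bound in simp)
  moreover have "k \<le> k'" if "1 \<le> k'" "degree_bound S k'" for k'
    unfolding k_def by (rule Least_le) (use that in simp)
  ultimately show ?thesis
    using bound by (auto simp: has_degree_def)
qed

end
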